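(* For every exotic coloured tree $\tau\in\mathcal{T}^{\mathfrak e}_{\alpha,\beta}$ with $|\tau|>1$, $$\frac{|\tau|!}{\tau!}=\sum_{\tau'\in\mathcal{R}^-_{\mathfrak e}(\tau)}\frac{|\tau'|!}{\tau'!}.$$
   Context: Exotic coloured trees: an exotic coloured tree $\tau$ is a finite non-planar rooted tree with edges oriented towards the root; the root is uncoloured; every non-root vertex has a colour in $\{\alpha,\beta\}$; the set $\mathcal V_\beta(\tau)$ of $\beta$-coloured vertices has even cardinality and is equipped with an exotic decoration $\mathfrak e$, i.e. a partition of $\mathcal V_\beta(\tau)$ into pairs ($\mathfrak e(v)=\mathfrak e(w)$ iff $v,w$ are in the same pair; labels irrelevant). Paired vertices may be anywhere in the tree. $\mathcal V_\alpha(\tau)$ is the set of $\alpha$-coloured vertices. $\mathcal{T}^{\mathfrak e}_{\alpha,\beta}$ is the set of isomorphism classes of such trees (including the single root $\bullet$). Set $|\tau|:=|\mathcal V_\alpha(\tau)|+\tfrac12|\mathcal V_\beta(\tau)|+1$; $|\tau|!$ is the usual factorial of this integer. Tree factorial: $1/\tau!$ is defined recursively by $1/\bullet!=1$ and, for $|\tau|>1$, $$\frac{|\tau|}{\tau!}=\sum_{\tau'}\frac{m_\alpha(\tau',\tau)}{\tau'!}+\sum_{\tau'}\frac{m_\beta(\tau',\tau)}{\tau'!},$$ where $m_\alpha(\tau',\tau)$ is the number of $\alpha$-coloured leaves of $\tau$ whose removal yields $\tau'$, $m_\beta(\tau',\tau)$ is the number of pairs of $\beta$-vertices with the same exotic decoration,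 both leaves of $\tau$, whose simultaneous removal yields $\tau'$, and sums run over isomorphism classes. Empty sums are zero (in which case $1/\tau!=0$). The family $\mathcal{R}^-_{\mathfrak e}(\tau)$: an effective edge of $\tau$ is either (i) an edge connecting the root with an $\alpha$-coloured vertex, or (ii) a double edge, consisting of the two edges connecting the root with two $\beta$-vertices having the same exotic decoration. (An edge joining the root to a $\beta$-vertex whose partner is not attached to the root is not effective.) For each effective edge, let $\tau'$ be the exotic tree obtained by removing the edge together with the vertex (resp. the pair of $\beta$-vertices) at its top and grafting the remaining subtrees of the branch(es) directly on the root. $\mathcal{R}^-_{\mathfrak e}(\tau)$ is the family of these trees, indexed by the effective edges of $\tau$, so isomorphic trees coming from different effective edges are counted separately. An empty sum is zero. *)

theory Defs
  imports Complex_Main "HOL-Library.Multiset" "HOL-Library.Disjoint_Sets"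
begin

section \<open>Labelled exotic coloured trees\<close>

datatype colour = Alpha | Beta

text \<open>
  The vertices of a labelled tree are natural numbers. The field \<open>verts\<close> contains the
  \<^emph>\<open>non-root\<close> vertices only: the root is implicit, and \<open>parent t v = None\<close> says that the edge
  leaving \<open>v\<close> ends in the root. The fields \<open>parent\<close> and \<open>colour\<close> are meaningful on \<open>verts\<close> only.
  The field \<open>pairs\<close> is the exotic decoration, given as a set of two-element sets.
\<close>

datatype lab_tree = Lab_Tree
  (verts: "nat set")
  (parent: "nat \<Rightarrow> nat option")
  (colour: "nat \<Rightarrow> colour")
  (pairs: "nat set set")

definition alpha_verts :: "lab_tree \<Rightarrow> nat set" where
  "alpha_verts t = {v \<in> verts t. colour t v = Alpha}"

definition beta_verts :: "lab_tree \<Rightarrow> nat set" where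
  "beta_verts t = {v \<in> verts t. colour t v = Beta}"

text \<open>
  Every non-root vertex has exactly one outgoing edge, so for a finite vertex set acyclicity says
  that each path along the edges ends in the root.
\<close>

definition exotic :: "lab_tree \<Rightarrow> bool" where
  "exotic t \<longleftrightarrow>
     finite (verts t) \<and>
     (\<forall>v\<in>verts t. \<forall>w. parent t v = Some w \<longrightarrow> w \<in> verts t) \<and>
     acyclic {(v, w). v \<in> verts t \<and> parent t v = Some w} \<and>
     partition_on (beta_verts t) (pairs t) \<and>
     (\<forall>p\<in>pairs t. card p = 2)"

definition is_iso :: "(nat \<Rightarrow> nat) \<Rightarrow> lab_tree \<Rightarrow> lab_tree \<Rightarrow> bool" where
  "is_iso f t t' \<longleftrightarrow>
     bij_betw f (verts t) (verts t') \<and>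
     (\<forall>v\<in>verts t. parent t' (f v) = map_option f (parent t v)) \<and>
     (\<forall>v\<in>verts t. colour t' (f v) = colour t v) \<and>
     (`) f ` pairs t = pairs t'"

definition tree_iso :: "lab_tree \<Rightarrow> lab_tree \<Rightarrow> bool" where
  "tree_iso t t' \<longleftrightarrow> exotic t \<and> exotic t' \<and> (\<exists>f. is_iso f t t')"

definition leaf :: "lab_tree \<Rightarrow> nat \<Rightarrow> bool" where
  "leaf t v \<longleftrightarrow> v \<in> verts t \<and> (\<forall>u\<in>verts t. parent t u \<noteq> Some v)"

text \<open>
  In the next two operations \<open>S\<close> is either a singleton consisting of an \<open>\<alpha>\<close>-vertex or one of the
  pairs of the decoration. The first one is used for leaves only, the second one for
  vertices attached to the root only.
\<close>

definition delete :: "nat set \<Rightarrow> lab_tree \<Rightarrow> lab_tree" where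
  "delete S t = Lab_Tree (verts t - S) (parent t) (colour t) (pairs t - {S})"

definition contract :: "nat set \<Rightarrow> lab_tree \<Rightarrow> lab_tree" where
  "contract S t =
     Lab_Tree (verts t - S)
       (\<lambda>v. if parent t v \<in> Some ` S then None else parent t v)
       (colour t)
       (pairs t - {S})"

definition alpha_leaves :: "lab_tree \<Rightarrow> nat set set" where
  "alpha_leaves t = {{v} |v. v \<in> alpha_verts t \<and> leaf t v}"

definition beta_leaf_pairs :: "lab_tree \<Rightarrow> nat set set" where
  "beta_leaf_pairs t = {p \<in> pairs t. \<forall>v\<in>p. leaf t v}"

text \<open>An effective edge is represented by the set of its top vertices.\<close>

definition effective_edges :: "lab_tree \<Rightarrow> nat set set" where
  "effective_edges t =
     {{v} |v. v \<in> alpha_verts t \<and> parent t v = None} \<union>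
     {p \<in> pairs t. \<forall>v\<in>p. parent t v = None}"

definition lab_size :: "lab_tree \<Rightarrow> nat" where
  "lab_size t = card (alpha_verts t) + card (beta_verts t) div 2 + 1"


section \<open>Transport along isomorphisms\<close>

lemma is_iso_refl: "is_iso id t t"
  by (auto simp: is_iso_def option.map_id0)

lemma is_iso_trans:
  assumes "is_iso f t t'" "is_iso g t' t''"
  shows "is_iso (g \<circ> f) t t''"
proof -
  have "\<And>v. v \<in> verts t \<Longrightarrow> f v \<in> verts t'"
    using assms(1) by (auto simp: is_iso_def bij_betw_def)
  moreover have "(`) (g \<circ> f) ` pairs t = pairs t''"
  proof -
    have "(`) (g \<circ> f) ` pairs t = (`) g ` (`) f ` pairs t"
      unfolding image_image by (simp add: image_comp)
    thus ?thesis using assms by (simp add: is_iso_def)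
  qed
  ultimately show ?thesis
    using assms unfolding is_iso_def
    by (auto simp: option.map_comp intro: bij_betw_trans)
qed

lemma exotic_parentD:
  "exotic t \<Longrightarrow> v \<in> verts t \<Longrightarrow> parent t v = Some w \<Longrightarrow> w \<in> verts t"
  by (auto simp: exotic_def)

lemma exotic_pairs_subset: "exotic t \<Longrightarrow> p \<in> pairs t \<Longrightarrow> p \<subseteq> beta_verts t"
  by (auto simp: exotic_def partition_on_def)

lemma beta_verts_subset: "beta_verts t \<subseteq> verts t"
  by (auto simp: beta_verts_def)

lemma alpha_verts_subset: "alpha_verts t \<subseteq> verts t"
  by (auto simp: alpha_verts_def)

lemma is_iso_sym:
  assumes ex: "exotic t" and f: "is_iso f t t'"
  shows "is_iso (inv_into (verts t) f) t' t"
proof -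
  let ?g = "inv_into (verts t) f"
  have bij: "bij_betw f (verts t) (verts t')"
    and par: "\<And>v. v \<in> verts t \<Longrightarrow> parent t' (f v) = map_option f (parent t v)"
    and col: "\<And>v. v \<in> verts t \<Longrightarrow> colour t' (f v) = colour t v"
    and prs: "(`) f ` pairs t = pairs t'"
    using f by (auto simp: is_iso_def)
  have gf: "\<And>v. v \<in> verts t \<Longrightarrow> ?g (f v) = v"
    using bij by (simp add: bij_betw_inv_into_left)
  have ver: "verts t' = f ` verts t"
    using bij by (simp add: bij_betw_def)
  have "parent t (?g w) = map_option ?g (parent t' w)" if w: "w \<in> verts t'" for w
  proof -
    obtain v where v: "v \<in> verts t" "w = f v" using w ver by auto
    show ?thesis
      using v par[OF v(1)] gf exotic_parentD[OF ex v(1)] by (cases "parent t v") auto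
  qed
  moreover have "colour t (?g w) = colour t' w" if "w \<in> verts t'" for w
    using that ver gf col by auto
  moreover have "(`) ?g ` pairs t' = pairs t"
  proof -
    have "?g ` f ` p = p" if "p \<in> pairs t" for p
    proof -
      have "p \<subseteq> verts t" using that ex exotic_pairs_subset beta_verts_subset by blast
      thus ?thesis using gf by (force simp: image_iff subset_iff)
    qed
    hence "(\<lambda>p. ?g ` f ` p) ` pairs t = pairs t" by simp
    thus ?thesis using prs by (metis image_image)
  qed
  ultimately show ?thesis
    using bij by (auto simp: is_iso_def bij_betw_inv_into)
qed

lemma tree_iso_sym: "tree_iso t t' \<Longrightarrow> tree_iso t' t"
  unfolding tree_iso_def using is_iso_sym by blast

lemma tree_iso_trans: "tree_iso t t' \<Longrightarrow> tree_iso t' t'' \<Longrightarrow> tree_iso t t''"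
  unfolding tree_iso_def using is_iso_trans by blast

lemma tree_iso_refl: "exotic t \<Longrightarrow> tree_iso t t"
  unfolding tree_iso_def using is_iso_refl by blast

definition bullet_lab :: lab_tree where
  "bullet_lab = Lab_Tree {} (\<lambda>_. None) (\<lambda>_. Alpha) {}"

lemma exotic_bullet: "exotic bullet_lab"
  by (auto simp: exotic_def bullet_lab_def beta_verts_def partition_on_def acyclic_def)

lemma tree_iso_part_equivp: "part_equivp tree_iso"
  by (rule part_equivpI) (auto intro: sympI transpI tree_iso_sym tree_iso_trans tree_iso_refl[OF exotic_bullet])

lemma is_iso_alpha: "is_iso f t t' \<Longrightarrow> alpha_verts t' = f ` alpha_verts t"
  by (simp add: is_iso_def alpha_verts_def bij_betw_def) (force simp: image_iff)

lemma is_iso_beta: "is_iso f t t' \<Longrightarrow> beta_verts t' = f ` beta_verts t"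
  by (simp add: is_iso_def beta_verts_def bij_betw_def) (force simp: image_iff)

lemma tree_iso_lab_size:
  assumes "tree_iso t t'" shows "lab_size t = lab_size t'"
proof -
  obtain f where f: "is_iso f t t'" using assms by (auto simp: tree_iso_def)
  hence inj: "inj_on f (verts t)" by (auto simp: is_iso_def bij_betw_def)
  have "card (alpha_verts t') = card (alpha_verts t)" "card (beta_verts t') = card (beta_verts t)"
    using is_iso_alpha[OF f] is_iso_beta[OF f] inj_on_subset[OF inj alpha_verts_subset]
      inj_on_subset[OF inj beta_verts_subset] by (auto simp: card_image)
  thus ?thesis by (simp add: lab_size_def)
qed

lemma is_iso_leaf:
  assumes "exotic t" "is_iso f t t'" "v \<in> verts t"
  shows "leaf t' (f v) \<longleftrightarrow> leaf t v"
proof -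
  have inj: "inj_on f (verts t)" and ver: "verts t' = f ` verts t"
    and par: "\<And>v. v \<in> verts t \<Longrightarrow> parent t' (f v) = map_option f (parent t v)"
    using assms(2) by (auto simp: is_iso_def bij_betw_def)
  have "parent t' (f u) = Some (f v) \<longleftrightarrow> parent t u = Some v" if "u \<in> verts t" for u
    using par[OF that] exotic_parentD[OF assms(1) that] inj assms(3)
    by (auto dest: inj_onD)
  thus ?thesis using assms(3) ver by (auto simp: leaf_def)
qed

lemma singletons_image:
  assumes "\<And>v. v \<in> A \<Longrightarrow> P' (f v) \<longleftrightarrow> P v"
  shows "{{v} |v. v \<in> f ` A \<and> P' v} = (`) f ` {{v} |v. v \<in> A \<and> P v}"
proof -
  have "{v. v \<in> f ` A \<and> P' v} = f ` {v. v \<in> A \<and> P v}" using assms by auto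
  thus ?thesis by (simp add: setcompr_eq_image image_image)
qed

lemma is_iso_alpha_leaves:
  assumes "exotic t" "is_iso f t t'"
  shows "alpha_leaves t' = (`) f ` alpha_leaves t"
  unfolding alpha_leaves_def is_iso_alpha[OF assms(2)]
  by (rule singletons_image) (use is_iso_leaf[OF assms] alpha_verts_subset[of t] in blast)

lemma is_iso_beta_leaf_pairs:
  assumes "exotic t" "is_iso f t t'"
  shows "beta_leaf_pairs t' = (`) f ` beta_leaf_pairs t"
proof -
  have prs: "pairs t' = (`) f ` pairs t" using assms(2) by (auto simp: is_iso_def)
  have "(\<forall>v\<in>f ` p. leaf t' v) \<longleftrightarrow> (\<forall>v\<in>p. leaf t v)" if "p \<in> pairs t" for p
    using is_iso_leaf[OF assms] exotic_pairs_subset[OF assms(1) that] beta_verts_subset[of t]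
    by auto
  thus ?thesis unfolding beta_leaf_pairs_def prs by auto
qed

lemma is_iso_effective_edges:
  assumes "exotic t" "is_iso f t t'"
  shows "effective_edges t' = (`) f ` effective_edges t"
proof -
  have prs: "pairs t' = (`) f ` pairs t" using assms(2) by (auto simp: is_iso_def)
  have par: "parent t' (f v) = None \<longleftrightarrow> parent t v = None" if "v \<in> verts t" for v
    using that assms(2) by (auto simp: is_iso_def)
  have "(\<forall>v\<in>f ` p. parent t' v = None) \<longleftrightarrow> (\<forall>v\<in>p. parent t v = None)"
    if "p \<in> pairs t" for p
  proof -
    have "\<forall>v\<in>p. parent t' (f v) = None \<longleftrightarrow> parent t v = None"
      using par exotic_pairs_subset[OF assms(1) that] beta_verts_subset[of t] by blast
    thus ?thesis by auto
  qed
  hence "{p \<in> pairs t'. \<forall>v\<in>p. parent t' v = None} =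
      (`) f ` {p \<in> pairs t. \<forall>v\<in>p. parent t v = None}"
    unfolding prs by auto
  moreover have "{{v} |v. v \<in> alpha_verts t' \<and> parent t' v = None} =
      (`) f ` {{v} |v. v \<in> alpha_verts t \<and> parent t v = None}"
    unfolding is_iso_alpha[OF assms(2)]
    by (rule singletons_image) (use par alpha_verts_subset[of t] in blast)
  ultimately show ?thesis by (auto simp: effective_edges_def image_Un)
qed

definition removable :: "lab_tree \<Rightarrow> nat set set" where
  "removable t = {{v} |v. v \<in> alpha_verts t} \<union> pairs t"

lemma alpha_leaves_removable: "alpha_leaves t \<subseteq> removable t"
  by (auto simp: alpha_leaves_def removable_def)

lemma beta_leaf_pairs_removable: "beta_leaf_pairs t \<subseteq> removable t"
  by (auto simp: beta_leaf_pairs_def removable_def)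

lemma effective_edges_removable: "effective_edges t \<subseteq> removable t"
  by (auto simp: effective_edges_def removable_def)

lemma removable_subset:
  assumes "exotic t" "S \<in> removable t"
  shows "S \<subseteq> verts t"
  using assms exotic_pairs_subset[OF assms(1)] alpha_verts_subset[of t] beta_verts_subset[of t]
  by (auto simp: removable_def)

lemma finite_removable: "exotic t \<Longrightarrow> finite (removable t)"
  using removable_subset finite_subset[of "removable t" "Pow (verts t)"]
  by (auto simp: exotic_def)

lemma partition_removable:
  assumes "exotic t" "S \<in> removable t"
  shows "partition_on (beta_verts t - S) (pairs t - {S})"
proof -
  have P: "partition_on (beta_verts t) (pairs t)" and c2: "\<And>p. p \<in> pairs t \<Longrightarrow> card p = 2"
    using assms(1) by (auto simp: exotic_def)
  consider v where "S = {v}" "v \<in> alpha_verts t" | "S \<in> pairs t"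
    using assms(2) by (auto simp: removable_def)
  thus ?thesis
  proof cases
    case 1
    have "S \<notin> pairs t" using c2[of S] 1 by auto
    moreover have "beta_verts t - S = beta_verts t"
      using 1 by (auto simp: alpha_verts_def beta_verts_def)
    ultimately show ?thesis using P by simp
  next
    case 2
    show ?thesis
    unfolding partition_on_def disjoint_def
    proof (intro conjI ballI impI)
      show "\<Union> (pairs t - {S}) = beta_verts t - S"
      proof -
        have "p \<inter> S = {}" if "p \<in> pairs t - {S}" for p
          using P 2 that by (auto simp: partition_on_def dest: disjointD)
        moreover have "beta_verts t = \<Union> (pairs t)" using P by (simp add: partition_on_def)
        ultimately show ?thesis by blast
      qed
      show "{} \<notin> pairs t - {S}" using c2 by fastforce
      show "p \<inter> q = {}" if "p \<in> pairs t - {S}" "q \<in> pairs t - {S}" "p \<noteq> q" for p q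
        using P that by (auto simp: partition_on_def dest: disjointD)
    qed
  qed
qed

lemma exotic_delete:
  assumes ex: "exotic t" and "S \<in> alpha_leaves t \<union> beta_leaf_pairs t"
  shows "exotic (delete S t)"
proof -
  have S: "S \<in> removable t"
    using assms(2) alpha_leaves_removable beta_leaf_pairs_removable by blast
  have lf: "\<And>v. v \<in> S \<Longrightarrow> leaf t v"
    using assms(2) by (auto simp: alpha_leaves_def beta_leaf_pairs_def)
  have "acyclic {(v, w). v \<in> verts t \<and> parent t v = Some w}" using ex by (auto simp: exotic_def)
  hence "acyclic {(v, w). v \<in> verts (delete S t) \<and> parent (delete S t) v = Some w}"
    by (rule acyclic_subset) (auto simp: delete_def)
  moreover have "beta_verts (delete S t) = beta_verts t - S"
    by (auto simp: beta_verts_def delete_def)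
  ultimately show ?thesis
    using ex partition_removable[OF ex S] lf
    by (auto simp: exotic_def delete_def leaf_def)
qed

lemma exotic_contract:
  assumes ex: "exotic t" and "S \<in> effective_edges t"
  shows "exotic (contract S t)"
proof -
  have S: "S \<in> removable t"
    using assms(2) effective_edges_removable by blast
  have "acyclic {(v, w). v \<in> verts t \<and> parent t v = Some w}" using ex by (auto simp: exotic_def)
  hence "acyclic {(v, w). v \<in> verts (contract S t) \<and> parent (contract S t) v = Some w}"
    by (rule acyclic_subset) (auto simp: contract_def split: if_splits)
  moreover have "beta_verts (contract S t) = beta_verts t - S"
    by (auto simp: beta_verts_def contract_def)
  ultimately show ?thesis
    using ex partition_removable[OF ex S]
    by (auto simp: exotic_def contract_def split: if_splits)
qed

lemma image_pairs_diff:
  assumes ex: "exotic t" and f: "is_iso f t t'" and S: "S \<in> removable t"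
  shows "(`) f ` (pairs t - {S}) = pairs t' - {f ` S}"
proof -
  have inj: "inj_on f (verts t)" using f by (auto simp: is_iso_def bij_betw_def)
  have sub: "\<And>p. p \<in> pairs t \<Longrightarrow> p \<subseteq> verts t"
    using removable_subset[OF ex] by (auto simp: removable_def)
  have "f ` p = f ` S \<longleftrightarrow> p = S" if "p \<in> pairs t" for p
    using inj_on_image_eq_iff[OF inj sub[OF that] removable_subset[OF ex S]] .
  moreover have "pairs t' = (`) f ` pairs t" using f by (auto simp: is_iso_def)
  ultimately show ?thesis by auto
qed

lemma bij_betw_verts_diff:
  assumes "exotic t" "is_iso f t t'" "S \<in> removable t"
  shows "bij_betw f (verts t - S) (verts t' - f ` S)"
proof -
  have inj: "inj_on f (verts t)" and ver: "f ` verts t = verts t'"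
    using assms(2) by (auto simp: is_iso_def bij_betw_def)
  have "f ` (verts t - S) = verts t' - f ` S"
    using inj_on_image_set_diff[OF inj Diff_subset removable_subset[OF assms(1,3)]] ver
    by simp
  thus ?thesis using inj by (simp add: bij_betw_def inj_on_diff)
qed

lemma is_iso_delete:
  assumes "exotic t" "is_iso f t t'" "S \<in> removable t"
  shows "is_iso f (delete S t) (delete (f ` S) t')"
  using assms(2) bij_betw_verts_diff[OF assms] image_pairs_diff[OF assms]
  unfolding is_iso_def delete_def by simp

lemma is_iso_contract:
  assumes "exotic t" "is_iso f t t'" "S \<in> removable t"
  shows "is_iso f (contract S t) (contract (f ` S) t')"
proof -
  have inj: "inj_on f (verts t)" using assms(2) by (auto simp: is_iso_def bij_betw_def)
  have "parent (contract (f ` S) t') (f v) = map_option f (parent (contract S t) v)"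
    if "v \<in> verts t" for v
  proof (cases "parent t v")
    case None
    thus ?thesis using that assms(2) by (auto simp: is_iso_def contract_def)
  next
    case (Some w)
    have "f w \<in> f ` S \<longleftrightarrow> w \<in> S"
      using inj_on_image_mem_iff[OF inj exotic_parentD[OF assms(1) that Some]
          removable_subset[OF assms(1,3)]] .
    thus ?thesis using that assms(2) Some by (auto simp: is_iso_def contract_def)
  qed
  thus ?thesis
    using assms(2) bij_betw_verts_diff[OF assms] image_pairs_diff[OF assms]
    unfolding is_iso_def by (auto simp: contract_def)
qed

lemma inj_on_image_removable:
  assumes "exotic t" "is_iso f t t'"
  shows "inj_on ((`) f) (removable t)"
  using assms removable_subset[OF assms(1)]
  by (intro inj_on_subset[OF inj_on_image_Pow, of f "verts t"]) (auto simp: is_iso_def bij_betw_def)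

lemma tree_iso_card_delete:
  assumes t: "tree_iso t t'" and s: "tree_iso s s'"
    and L: "\<And>t t' f. exotic t \<Longrightarrow> is_iso f t t' \<Longrightarrow> L t' = (`) f ` L t"
    and R: "\<And>t. L t \<subseteq> alpha_leaves t \<union> beta_leaf_pairs t"
  shows "card {S \<in> L t. tree_iso (delete S t) s} = card {S \<in> L t'. tree_iso (delete S t') s'}"
proof -
  obtain f where f: "is_iso f t t'" and ex: "exotic t" "exotic t'" using t by (auto simp: tree_iso_def)
  have rem: "L t \<subseteq> removable t"
    using R alpha_leaves_removable beta_leaf_pairs_removable by blast
  have del: "tree_iso (delete S t) (delete (f ` S) t')" if "S \<in> L t" for S
  proof -
    have "f ` S \<in> L t'" using that L[OF ex(1) f] by auto
    thus ?thesis unfolding tree_iso_def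
      using is_iso_delete[OF ex(1) f] that rem exotic_delete ex R by blast
  qed
  have "tree_iso (delete S t) s \<longleftrightarrow> tree_iso (delete (f ` S) t') s'" if "S \<in> L t" for S
    using del[OF that] s by (meson tree_iso_sym tree_iso_trans)
  hence "{S \<in> L t'. tree_iso (delete S t') s'} = (`) f ` {S \<in> L t. tree_iso (delete S t) s}"
    unfolding L[OF ex(1) f] by auto
  moreover have "inj_on ((`) f) {S \<in> L t. tree_iso (delete S t) s}"
    by (rule inj_on_subset[OF inj_on_image_removable[OF ex(1) f]]) (use rem in auto)
  ultimately show ?thesis by (simp add: card_image)
qed


section \<open>Isomorphism classes\<close>

quotient_type exotic_tree = lab_tree / partial: tree_iso
  by (rule tree_iso_part_equivp)

lift_definition bullet :: exotic_tree is bullet_lab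
  by (rule tree_iso_refl[OF exotic_bullet])

lift_definition tree_size :: "exotic_tree \<Rightarrow> nat" is lab_size
  by (rule tree_iso_lab_size)

text \<open>
  \<open>m_alpha \<sigma> \<tau>\<close> and \<open>m_beta \<sigma> \<tau>\<close> are the numbers of \<open>\<alpha>\<close>-leaves, resp. of pairs of
  \<open>\<beta>\<close>-leaves with the same decoration, whose removal from \<open>\<tau>\<close> yields \<open>\<sigma>\<close>.
\<close>

lift_definition m_alpha :: "exotic_tree \<Rightarrow> exotic_tree \<Rightarrow> nat"
  is "\<lambda>s t. card {S \<in> alpha_leaves t. tree_iso (delete S t) s}"
  by (rule tree_iso_card_delete, assumption, assumption, erule (1) is_iso_alpha_leaves, blast)

lift_definition m_beta :: "exotic_tree \<Rightarrow> exotic_tree \<Rightarrow> nat"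
  is "\<lambda>s t. card {S \<in> beta_leaf_pairs t. tree_iso (delete S t) s}"
  by (rule tree_iso_card_delete, assumption, assumption, erule (1) is_iso_beta_leaf_pairs, blast)

text \<open>
  The family of trees indexed by the effective edges, as a multiset of isomorphism classes.
\<close>

lift_definition R_minus :: "exotic_tree \<Rightarrow> exotic_tree multiset"
  is "\<lambda>t. {#contract S t. S \<in># mset_set (effective_edges t)#}"
proof -
  fix t t' assume "tree_iso t t'"
  then obtain f where f: "is_iso f t t'" and ex: "exotic t" "exotic t'" by (auto simp: tree_iso_def)
  have inj: "inj_on ((`) f) (effective_edges t)"
    by (rule inj_on_subset[OF inj_on_image_removable[OF ex(1) f] effective_edges_removable])
  have fin: "finite (effective_edges t)"
    using finite_subset[OF effective_edges_removable finite_removable[OF ex(1)]] .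
  have eq: "mset_set (effective_edges t') = image_mset ((`) f) (mset_set (effective_edges t))"
    using is_iso_effective_edges[OF ex(1) f] image_mset_mset_set[OF inj] by simp
  have "tree_iso (contract S t) (contract (f ` S) t')" if "S \<in> effective_edges t" for S
    unfolding tree_iso_def
    using that exotic_contract[OF ex(1)] exotic_contract[OF ex(2)]
      is_iso_effective_edges[OF ex(1) f] is_iso_contract[OF ex(1) f] effective_edges_removable
    by blast
  thus "rel_mset tree_iso {#contract S t. S \<in># mset_set (effective_edges t)#}
      {#contract S t'. S \<in># mset_set (effective_edges t')#}"
    unfolding eq by (auto simp: multiset.map_comp multiset.rel_map fin intro!: multiset.rel_refl_strong)
qed


section \<open>The inverse tree factorial\<close>

lemma lab_size_delete:
  assumes ex: "exotic t" and S: "S \<in> removable t"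
  shows "lab_size (delete S t) < lab_size t"
proof -
  have a: "alpha_verts (delete S t) = alpha_verts t - S" "beta_verts (delete S t) = beta_verts t - S"
    by (auto simp: alpha_verts_def beta_verts_def delete_def)
  have fin: "finite (alpha_verts t)" "finite (beta_verts t)"
    using ex finite_subset[OF alpha_verts_subset] finite_subset[OF beta_verts_subset]
    by (auto simp: exotic_def)
  consider v where "S = {v}" "v \<in> alpha_verts t" | "S \<in> pairs t"
    using S by (auto simp: removable_def)
  thus ?thesis
  proof cases
    case 1
    have "card (alpha_verts t - S) < card (alpha_verts t)"
      using 1 fin by (intro psubset_card_mono) auto
    moreover have "card (beta_verts t - S) \<le> card (beta_verts t)"
      using fin by (intro card_mono) auto
    ultimately show ?thesis
      unfolding lab_size_def a using div_le_mono[of _ _ 2] by (fastforce intro: add_less_le_mono)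
  next
    case 2
    have sub: "S \<subseteq> beta_verts t" using exotic_pairs_subset[OF ex 2] .
    have "card S = 2" using ex 2 by (auto simp: exotic_def)
    hence "card (beta_verts t - S) = card (beta_verts t) - 2" "card (beta_verts t) \<ge> 2"
      using sub fin card_mono[OF fin(2) sub] by (auto simp: card_Diff_subset finite_subset)
    moreover have "card (alpha_verts t - S) \<le> card (alpha_verts t)"
      using fin by (intro card_mono) auto
    ultimately show ?thesis unfolding lab_size_def a by linarith
  qed
qed

lemma m_alpha_less: "m_alpha \<sigma> \<tau> \<noteq> 0 \<Longrightarrow> tree_size \<sigma> < tree_size \<tau>"
proof transfer
  fix s t assume "tree_iso t t" and "card {S \<in> alpha_leaves t. tree_iso (delete S t) s} \<noteq> 0"
  then obtain S where "exotic t" "S \<in> alpha_leaves t" "tree_iso (delete S t) s"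
    by (metis (no_types, lifting) card.empty equals0I tree_iso_def mem_Collect_eq)
  thus "lab_size s < lab_size t"
    using lab_size_delete tree_iso_lab_size alpha_leaves_removable by (metis subsetD)
qed

lemma m_beta_less: "m_beta \<sigma> \<tau> \<noteq> 0 \<Longrightarrow> tree_size \<sigma> < tree_size \<tau>"
proof transfer
  fix s t assume "tree_iso t t" and "card {S \<in> beta_leaf_pairs t. tree_iso (delete S t) s} \<noteq> 0"
  then obtain S where "exotic t" "S \<in> beta_leaf_pairs t" "tree_iso (delete S t) s"
    by (metis (no_types, lifting) card.empty equals0I tree_iso_def mem_Collect_eq)
  thus "lab_size s < lab_size t"
    using lab_size_delete tree_iso_lab_size beta_leaf_pairs_removable by (metis subsetD)
qed

text \<open>
  \<open>inv_tree_fact \<tau>\<close> is the number written \<open>1/\<tau>!\<close>, which may be zero. The sums over all isomorphism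
  classes are restricted to the classes with nonzero multiplicity, of which there are finitely many.
\<close>

function inv_tree_fact :: "exotic_tree \<Rightarrow> real" where
  "inv_tree_fact \<tau> =
     (if \<tau> = bullet then 1
      else ((\<Sum>\<sigma> \<in> {\<sigma>. m_alpha \<sigma> \<tau> \<noteq> 0}. real (m_alpha \<sigma> \<tau>) * inv_tree_fact \<sigma>) +
            (\<Sum>\<sigma> \<in> {\<sigma>. m_beta \<sigma> \<tau> \<noteq> 0}. real (m_beta \<sigma> \<tau>) * inv_tree_fact \<sigma>))
           / real (tree_size \<tau>))"
  by auto
termination
  by (relation "measure tree_size") (auto intro: m_alpha_less m_beta_less)

declare inv_tree_fact.simps [simp del]

lemma exotic_tree_cases:
  obtains t where "exotic t" "tree_iso t t" "\<tau> = abs_exotic_tree t"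
  using Quotient_abs_rep[OF Quotient_exotic_tree] Quotient_rep_reflp[OF Quotient_exotic_tree]
  by (metis tree_iso_def)

lemma finite_m_alpha: "finite {\<sigma>. m_alpha \<sigma> \<tau> \<noteq> 0}"
proof (cases \<tau> rule: exotic_tree_cases)
  case (1 t)
  have "\<sigma> \<in> (\<lambda>S. abs_exotic_tree (delete S t)) ` alpha_leaves t" if "m_alpha \<sigma> \<tau> \<noteq> 0" for \<sigma>
  proof (cases \<sigma> rule: exotic_tree_cases)
    case s: (1 s)
    have "card {S \<in> alpha_leaves t. tree_iso (delete S t) s} \<noteq> 0"
      using that m_alpha.abs_eq[OF s(2) 1(2)] s(3) 1(3) by simp
    then obtain S where "S \<in> alpha_leaves t" "tree_iso (delete S t) s"
      by (metis (no_types, lifting) card.empty equals0I mem_Collect_eq)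
    thus ?thesis using Quotient_rel_abs[OF Quotient_exotic_tree] s(3) by (metis image_eqI)
  qed
  thus ?thesis
    using finite_subset[OF alpha_leaves_removable finite_removable[OF 1(1)]]
    by (auto intro: finite_surj)
qed

lemma finite_m_beta: "finite {\<sigma>. m_beta \<sigma> \<tau> \<noteq> 0}"
proof (cases \<tau> rule: exotic_tree_cases)
  case (1 t)
  have "\<sigma> \<in> (\<lambda>S. abs_exotic_tree (delete S t)) ` beta_leaf_pairs t" if "m_beta \<sigma> \<tau> \<noteq> 0" for \<sigma>
  proof (cases \<sigma> rule: exotic_tree_cases)
    case s: (1 s)
    have "card {S \<in> beta_leaf_pairs t. tree_iso (delete S t) s} \<noteq> 0"
      using that m_beta.abs_eq[OF s(2) 1(2)] s(3) 1(3) by simp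
    then obtain S where "S \<in> beta_leaf_pairs t" "tree_iso (delete S t) s"
      by (metis (no_types, lifting) card.empty equals0I mem_Collect_eq)
    thus ?thesis using Quotient_rel_abs[OF Quotient_exotic_tree] s(3) by (metis image_eqI)
  qed
  thus ?thesis
    using finite_subset[OF beta_leaf_pairs_removable finite_removable[OF 1(1)]]
    by (auto intro: finite_surj)
qed

lemma even_card_beta_verts:
  assumes "exotic t" shows "even (card (beta_verts t))"
proof -
  have P: "partition_on (beta_verts t) (pairs t)" and c2: "\<And>p. p \<in> pairs t \<Longrightarrow> card p = 2"
    and fin: "finite (beta_verts t)"
    using assms finite_subset[OF beta_verts_subset] by (auto simp: exotic_def)
  have "card (beta_verts t) = (\<Sum>p\<in>pairs t. card p)"
    using product_partition[OF P] c2 by (metis card.infinite zero_neq_numeral)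
  thus ?thesis using c2 by (simp add: dvd_sum)
qed

lemma tree_size_eq_1_iff: "tree_size \<tau> = 1 \<longleftrightarrow> \<tau> = bullet"
proof
  assume "\<tau> = bullet"
  thus "tree_size \<tau> = 1"
    by (simp add: bullet.abs_eq tree_size.abs_eq[OF tree_iso_refl[OF exotic_bullet]] lab_size_def)
      (simp add: alpha_verts_def beta_verts_def bullet_lab_def)
next
  assume sz: "tree_size \<tau> = 1"
  show "\<tau> = bullet"
  proof (cases \<tau> rule: exotic_tree_cases)
    case (1 t)
    have fin: "finite (verts t)" using 1(1) by (simp add: exotic_def)
    have "lab_size t = 1" using sz 1 tree_size.abs_eq by metis
    hence "card (alpha_verts t) = 0" "card (beta_verts t) = 0"
      using even_card_beta_verts[OF 1(1)] by (auto simp: lab_size_def elim: evenE)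
    hence "alpha_verts t = {}" "beta_verts t = {}"
      using finite_subset[OF alpha_verts_subset fin] finite_subset[OF beta_verts_subset fin] by auto
    moreover have "verts t = alpha_verts t \<union> beta_verts t"
      using colour.exhaust by (auto simp: alpha_verts_def beta_verts_def)
    ultimately have v: "verts t = {}" and b: "beta_verts t = {}" by auto
    have "pairs t = {}"
      using 1(1) b by (auto simp: exotic_def partition_on_def)
    hence "is_iso id t bullet_lab"
      using v by (simp add: is_iso_def bullet_lab_def)
    hence "tree_iso t bullet_lab"
      using 1(1) exotic_bullet by (auto simp: tree_iso_def)
    thus ?thesis
      using Quotient_rel_abs[OF Quotient_exotic_tree] 1(3) by (simp add: bullet.abs_eq)
  qed
qed

end

theory Submission
  imports Defs
begin

text \<open>
  Call an \<open>\<alpha>\<close>-vertex, or a pair of the decoration, a block of \<open>\<tau>\<close>; a tree of size \<open>n\<close> has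
  \<open>n - 1\<close> of them. Removing a block lowers the size by one, so multiplying the recursion for
  \<open>1/\<tau>!\<close> by \<open>(|\<tau>| - 1)!\<close> shows that \<open>|\<tau>|!/\<tau>!\<close> is the sum of \<open>|\<tau>'|!/\<tau>'!\<close> over the trees
  \<open>\<tau>'\<close> obtained by deleting one block of leaves. Thus \<open>|\<tau>|!/\<tau>!\<close> counts the orderings of the
  blocks in which the block of every vertex comes strictly before the block of its parent,
  unless the parent is the root. Deleting leaves builds such an ordering from the front;
  contracting effective edges builds the same orderings from the back, which is why the
  second recursion holds.

  The formal proof replaces the orderings by an induction on the size. Unfold
  \<open>|\<tau>|!/\<tau>!\<close> along the leaf recursion (lemma \<open>tree_weight_leaf_recursion\<close>), and each deleted tree
  along the root recursion, by the induction hypothesis. The two operations commute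
  (\<open>delete_contract_commute\<close>), and neither creates nor destroys the possibility of performing
  the other on a different block (\<open>effective_edges_delete\<close>, \<open>leaf_blocks_contract\<close>). The double
  sum therefore ranges over all pairs of a leaf block and a different effective block, and after
  exchanging the summations the inner sum is the leaf recursion of a contracted tree. The
  induction hypothesis needs the smaller tree to have a block, so the start is size two, where
  the only block is a leaf block exactly if it is effective
  (\<open>leaf_blocks_eq_effective_edges_if_size_2\<close>).

  The exchange of sums takes place on labelled trees, where blocks can be compared before and
  after an operation; \<open>sum_multiplicities\<close> turns the sums over isomorphism classes in the
  definition of \<open>1/\<tau>!\<close> into sums over the blocks of a labelled representative.
\<close>

section \<open>Blocks and their removal\<close>

definition leaf_blocks :: "lab_tree \<Rightarrow> nat set set" where
  "leaf_blocks t = alpha_leaves t \<union> beta_leaf_pairs t"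

lemma leaf_blocks_removable: "leaf_blocks t \<subseteq> removable t"
  using alpha_leaves_removable beta_leaf_pairs_removable by (auto simp: leaf_blocks_def)

lemma leaf_blocks_eq: "leaf_blocks t = {S \<in> removable t. \<forall>v\<in>S. leaf t v}"
  by (auto simp: leaf_blocks_def alpha_leaves_def beta_leaf_pairs_def removable_def)

lemma effective_edges_eq: "effective_edges t = {S \<in> removable t. \<forall>v\<in>S. parent t v = None}"
  by (auto simp: effective_edges_def removable_def)

lemma finite_leaf_blocks: "exotic t \<Longrightarrow> finite (leaf_blocks t)"
  using finite_removable finite_subset leaf_blocks_removable by blast

lemma finite_effective_edges: "exotic t \<Longrightarrow> finite (effective_edges t)"
  using finite_removable finite_subset effective_edges_removable by blast

lemma removable_nonempty: "exotic t \<Longrightarrow> S \<in> removable t \<Longrightarrow> S \<noteq> {}"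
  by (auto simp: removable_def exotic_def)

lemma removable_disjoint:
  assumes "exotic t" "S \<in> removable t" "R \<in> removable t" "R \<noteq> S"
  shows "R \<inter> S = {}"
proof -
  have "disjoint (pairs t)" using assms(1) by (auto simp: exotic_def partition_on_def)
  moreover have "\<And>p. p \<in> pairs t \<Longrightarrow> p \<inter> alpha_verts t = {}"
    using exotic_pairs_subset[OF assms(1)] by (fastforce simp: alpha_verts_def beta_verts_def)
  ultimately show ?thesis
    using assms(2-4) unfolding removable_def by (auto dest: disjointD)
qed

lemma removable_remove:
  assumes "exotic t" "S \<in> removable t"
  shows "removable (delete S t) = removable t - {S}"
    and "removable (contract S t) = removable t - {S}"
proof -
  have "v \<notin> S \<longleftrightarrow> {v} \<noteq> S" if "v \<in> alpha_verts t" for v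
    using removable_disjoint[OF assms, of "{v}"] removable_nonempty[OF assms] that
    by (auto simp: removable_def)
  hence "{{v} |v. v \<in> alpha_verts t - S} \<union> (pairs t - {S}) = removable t - {S}"
    unfolding removable_def by blast
  moreover have "alpha_verts (delete S t) = alpha_verts t - S"
    "alpha_verts (contract S t) = alpha_verts t - S"
    by (auto simp: alpha_verts_def delete_def contract_def)
  ultimately show "removable (delete S t) = removable t - {S}"
    and "removable (contract S t) = removable t - {S}"
    by (simp_all only: removable_def) (simp_all add: delete_def contract_def)
qed

lemma lab_size_remove:
  assumes ex: "exotic t" and S: "S \<in> removable t"
  shows "Suc (lab_size (delete S t)) = lab_size t"
    and "Suc (lab_size (contract S t)) = lab_size t"
proof -
  have fin: "finite (alpha_verts t)" "finite (beta_verts t)"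
    using ex finite_subset[OF alpha_verts_subset] finite_subset[OF beta_verts_subset]
    by (auto simp: exotic_def)
  consider v where "S = {v}" "v \<in> alpha_verts t" | "S \<in> pairs t"
    using S by (auto simp: removable_def)
  hence "Suc (card (alpha_verts t - S) + card (beta_verts t - S) div 2 + 1) = lab_size t"
  proof cases
    case 1
    hence "beta_verts t - S = beta_verts t" by (auto simp: alpha_verts_def beta_verts_def)
    moreover have "Suc (card (alpha_verts t - S)) = card (alpha_verts t)"
      using 1 fin by (metis card_Suc_Diff1)
    ultimately show ?thesis by (simp add: lab_size_def)
  next
    case 2
    have sub: "S \<subseteq> beta_verts t" using exotic_pairs_subset[OF ex 2] .
    have "card S = 2" using ex 2 by (auto simp: exotic_def)
    hence "card (beta_verts t - S) = card (beta_verts t) - 2" "card (beta_verts t) \<ge> 2"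
      using sub fin card_mono[OF fin(2) sub] by (auto simp: card_Diff_subset finite_subset)
    moreover have "alpha_verts t - S = alpha_verts t"
      using sub by (auto simp: alpha_verts_def beta_verts_def)
    ultimately show ?thesis by (auto simp: lab_size_def)
  qed
  moreover have "alpha_verts (delete S t) = alpha_verts t - S" "beta_verts (delete S t) = beta_verts t - S"
    "alpha_verts (contract S t) = alpha_verts t - S" "beta_verts (contract S t) = beta_verts t - S"
    by (auto simp: alpha_verts_def beta_verts_def delete_def contract_def)
  ultimately show "Suc (lab_size (delete S t)) = lab_size t"
    and "Suc (lab_size (contract S t)) = lab_size t"
    by (simp_all add: lab_size_def)
qed

section \<open>Independence of deletion and contraction\<close>

lemma effective_edges_delete:
  assumes "exotic t" "S \<in> removable t"
  shows "effective_edges (delete S t) = effective_edges t - {S}"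
  unfolding effective_edges_eq removable_remove[OF assms] by (auto simp: delete_def)

text \<open>
  A vertex attached to the root is not the child of any non-root vertex, so cutting it off does
  not turn a non-leaf into a leaf.
\<close>
lemma leaf_blocks_contract:
  assumes "exotic t" "R \<in> effective_edges t"
  shows "leaf_blocks (contract R t) = leaf_blocks t - {R}"
proof -
  have R: "R \<in> removable t" and None: "\<And>v. v \<in> R \<Longrightarrow> parent t v = None"
    using assms(2) by (auto simp: effective_edges_eq)
  have "leaf (contract R t) v \<longleftrightarrow> leaf t v" if "v \<notin> R" for v
    using that None by (force simp: leaf_def contract_def)
  moreover have "v \<notin> R" if "v \<in> S" "S \<in> removable t" "S \<noteq> R" for S v
    using removable_disjoint[OF assms(1) R that(2,3)] that(1) by auto
  ultimately show ?thesis
    unfolding leaf_blocks_eq removable_remove[OF assms(1) R] by blast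
qed

lemma delete_contract_commute: "delete S (contract R t) = contract R (delete S t)"
  by (auto simp: delete_def contract_def)

lemma abs_exotic_tree_eq_iff:
  "exotic s \<Longrightarrow> exotic t \<Longrightarrow> abs_exotic_tree s = abs_exotic_tree t \<longleftrightarrow> tree_iso s t"
  using Quotient_rel[OF Quotient_exotic_tree] tree_iso_refl by blast

lemma abs_exotic_tree_eq_bullet_if_size_1:
  assumes "exotic t" "lab_size t = 1"
  shows "abs_exotic_tree t = bullet"
  using tree_size.abs_eq[OF tree_iso_refl[OF assms(1)]] assms(2) tree_size_eq_1_iff by auto

lemma verts_empty_if_size_1:
  assumes "exotic t" "lab_size t = 1"
  shows "verts t = {}"
proof -
  have "tree_iso t bullet_lab"
    using abs_exotic_tree_eq_bullet_if_size_1[OF assms]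
      abs_exotic_tree_eq_iff[OF assms(1) exotic_bullet] by (simp add: bullet.abs_eq)
  thus ?thesis by (auto simp: tree_iso_def is_iso_def bullet_lab_def bij_betw_def)
qed

text \<open>
  If a single block contains all vertices, both conditions say that no edge joins two non-root
  vertices. That the block does contain all vertices is obtained by removing it: what
  remains has size one.
\<close>
lemma leaf_blocks_eq_effective_edges_if_size_2:
  assumes ex: "exotic t" and sz: "lab_size t = 2"
  shows "leaf_blocks t = effective_edges t"
proof -
  have "S \<in> effective_edges t" if S: "S \<in> leaf_blocks t" for S
  proof -
    have rem: "S \<in> removable t" and leaf: "\<And>v. v \<in> S \<Longrightarrow> leaf t v"
      using S by (auto simp: leaf_blocks_eq)
    have "exotic (delete S t)" "lab_size (delete S t) = 1"
      using S exotic_delete[OF ex] lab_size_remove(1)[OF ex rem] sz by (auto simp: leaf_blocks_def)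
    hence "verts t \<subseteq> S" using verts_empty_if_size_1 by (force simp: delete_def)
    moreover have "w \<in> verts t" if "v \<in> S" "parent t v = Some w" for v w
      using that removable_subset[OF ex rem] exotic_parentD[OF ex] by blast
    ultimately have "parent t v = None" if "v \<in> S" for v
      using that leaf removable_subset[OF ex rem] unfolding leaf_def
      by (cases "parent t v") blast+
    thus ?thesis using rem by (auto simp: effective_edges_eq)
  qed
  moreover have "S \<in> leaf_blocks t" if S: "S \<in> effective_edges t" for S
  proof -
    have rem: "S \<in> removable t" and None: "\<And>v. v \<in> S \<Longrightarrow> parent t v = None"
      using S by (auto simp: effective_edges_eq)
    have "exotic (contract S t)" "lab_size (contract S t) = 1"
      using S exotic_contract[OF ex] lab_size_remove(2)[OF ex rem] sz by auto
    hence "verts t \<subseteq> S" using verts_empty_if_size_1 by (force simp: contract_def)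
    hence "leaf t v" if "v \<in> S" for v
      using that None removable_subset[OF ex rem] by (fastforce simp: leaf_def)
    thus ?thesis using rem by (auto simp: leaf_blocks_eq)
  qed
  ultimately show ?thesis by blast
qed

section \<open>The two recursions\<close>

definition tree_weight :: "lab_tree \<Rightarrow> real" where
  "tree_weight t = fact (lab_size t) * inv_tree_fact (abs_exotic_tree t)"

text \<open>
  A sum over isomorphism classes weighted by multiplicities is a sum over the removed blocks,
  grouped by the class of the resulting tree. The function \<open>m\<close> stands for \<open>m_alpha\<close> or \<open>m_beta\<close>.
\<close>
lemma sum_multiplicities:
  fixes h :: "exotic_tree \<Rightarrow> real"
  assumes fin: "finite L" and exd: "\<And>S. S \<in> L \<Longrightarrow> exotic (delete S t)"
    and m: "\<And>s. exotic s \<Longrightarrow> m (abs_exotic_tree s) = card {S \<in> L. tree_iso (delete S t) s}"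
  shows "(\<Sum>\<sigma> | m \<sigma> \<noteq> 0. real (m \<sigma>) * h \<sigma>) = (\<Sum>S\<in>L. h (abs_exotic_tree (delete S t)))"
proof -
  let ?c = "\<lambda>S. abs_exotic_tree (delete S t)"
  have m': "m \<sigma> = card {S \<in> L. ?c S = \<sigma>}" for \<sigma>
  proof (cases \<sigma> rule: exotic_tree_cases)
    case (1 s)
    have "{S \<in> L. ?c S = \<sigma>} = {S \<in> L. tree_iso (delete S t) s}"
      using abs_exotic_tree_eq_iff[OF exd 1(1)] 1(3) by auto
    thus ?thesis using m[OF 1(1)] 1(3) by simp
  qed
  have "{\<sigma>. m \<sigma> \<noteq> 0} = ?c ` L"
    using fin by (auto simp: m')
  hence "(\<Sum>\<sigma> | m \<sigma> \<noteq> 0. real (m \<sigma>) * h \<sigma>) = (\<Sum>\<sigma>\<in>?c ` L. \<Sum>S | S \<in> L \<and> ?c S = \<sigma>. h (?c S))"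
    by (simp add: m')
  also have "\<dots> = (\<Sum>S\<in>L. h (?c S))"
    by (rule sum.image_gen[OF fin, symmetric])
  finally show ?thesis .
qed

text \<open>
  Multiplying the defining recursion by \<open>(|\<tau>| - 1)!\<close> absorbs the factor \<open>|\<tau>|\<close> on the left, and
  on the right it supplies the factorial of the size of every deleted tree.
\<close>
lemma tree_weight_leaf_recursion:
  assumes ex: "exotic t" and sz: "lab_size t > 1"
  shows "tree_weight t = (\<Sum>S\<in>leaf_blocks t. tree_weight (delete S t))"
proof -
  let ?\<tau> = "abs_exotic_tree t" and ?h = "\<lambda>S. inv_tree_fact (abs_exotic_tree (delete S t))"
  have tt: "tree_iso t t" using ex by (rule tree_iso_refl)
  have size: "tree_size ?\<tau> = lab_size t" using tt by (rule tree_size.abs_eq)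
  hence nb: "?\<tau> \<noteq> bullet" using sz tree_size_eq_1_iff[of ?\<tau>] by auto
  have fin: "finite (alpha_leaves t)" "finite (beta_leaf_pairs t)"
    using finite_leaf_blocks[OF ex] by (auto simp: leaf_blocks_def)
  have disj: "alpha_leaves t \<inter> beta_leaf_pairs t = {}"
    using ex by (auto simp: alpha_leaves_def beta_leaf_pairs_def exotic_def)
  have "(\<Sum>\<sigma> | m_alpha \<sigma> ?\<tau> \<noteq> 0. real (m_alpha \<sigma> ?\<tau>) * inv_tree_fact \<sigma>) = (\<Sum>S\<in>alpha_leaves t. ?h S)"
    by (rule sum_multiplicities[OF fin(1)])
      (auto intro: exotic_delete[OF ex] m_alpha.abs_eq tt tree_iso_refl)
  moreover have "(\<Sum>\<sigma> | m_beta \<sigma> ?\<tau> \<noteq> 0. real (m_beta \<sigma> ?\<tau>) * inv_tree_fact \<sigma>) = (\<Sum>S\<in>beta_leaf_pairs t. ?h S)"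
    by (rule sum_multiplicities[OF fin(2)])
      (auto intro: exotic_delete[OF ex] m_beta.abs_eq tt tree_iso_refl)
  ultimately have "inv_tree_fact ?\<tau> = (\<Sum>S\<in>leaf_blocks t. ?h S) / real (lab_size t)"
    using nb sum.union_disjoint[OF fin disj, of ?h]
    by (subst inv_tree_fact.simps) (simp add: size leaf_blocks_def)
  moreover have "fact (lab_size t) = real (lab_size t) * fact (lab_size t - 1)"
    using sz by (simp add: fact_reduce)
  ultimately have "tree_weight t = (\<Sum>S\<in>leaf_blocks t. fact (lab_size t - 1) * ?h S)"
    using sz unfolding tree_weight_def sum_distrib_left[symmetric] by simp
  also have "\<dots> = (\<Sum>S\<in>leaf_blocks t. tree_weight (delete S t))"
  proof (rule sum.cong)
    fix S assume "S \<in> leaf_blocks t"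
    hence "Suc (lab_size (delete S t)) = lab_size t"
      using lab_size_remove(1)[OF ex] leaf_blocks_removable by blast
    thus "fact (lab_size t - 1) * ?h S = tree_weight (delete S t)"
      by (simp add: tree_weight_def flip: \<open>Suc _ = _\<close>)
  qed simp
  finally show ?thesis .
qed

lemma tree_weight_size_1:
  assumes "exotic t" "lab_size t = 1"
  shows "tree_weight t = 1"
  using abs_exotic_tree_eq_bullet_if_size_1[OF assms] assms(2)
  by (simp add: tree_weight_def inv_tree_fact.simps)

text \<open>
  The induction exchanges the order in which a leaf block \<open>S\<close> and an effective block \<open>R\<close> are
  removed. The case \<open>S = R\<close> occurs in neither double sum, since a block can be removed only once.
\<close>
lemma tree_weight_root_recursion:
  assumes "exotic t" "lab_size t > 1"
  shows "tree_weight t = (\<Sum>R\<in>effective_edges t. tree_weight (contract R t))"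
  using assms
proof (induction "lab_size t" arbitrary: t rule: less_induct)
  case less
  note ex = less.prems(1)
  have exD: "exotic (delete S t)" "Suc (lab_size (delete S t)) = lab_size t" if "S \<in> leaf_blocks t" for S
    using that exotic_delete[OF ex] lab_size_remove(1)[OF ex] leaf_blocks_removable
    by (auto simp: leaf_blocks_def subset_iff)
  have exC: "exotic (contract R t)" "Suc (lab_size (contract R t)) = lab_size t"
    if "R \<in> effective_edges t" for R
    using that exotic_contract[OF ex] lab_size_remove(2)[OF ex] effective_edges_removable
    by (auto simp: subset_iff)
  show ?case
  proof (cases "lab_size t = 2")
    case True
    have "(\<Sum>S\<in>leaf_blocks t. tree_weight (delete S t)) = (\<Sum>S\<in>effective_edges t. tree_weight (contract S t))"
      unfolding leaf_blocks_eq_effective_edges_if_size_2[OF ex True, symmetric]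
      using exD exC leaf_blocks_eq_effective_edges_if_size_2[OF ex True] True
      by (intro sum.cong) (simp_all add: tree_weight_size_1)
    thus ?thesis using tree_weight_leaf_recursion[OF less.prems] by simp
  next
    case False
    hence big: "lab_size t > 2" using less.prems(2) by simp
    have "tree_weight t = (\<Sum>S\<in>leaf_blocks t. tree_weight (delete S t))"
      using tree_weight_leaf_recursion[OF less.prems] .
    also have "\<dots> = (\<Sum>S\<in>leaf_blocks t. \<Sum>R\<in>effective_edges t - {S}. tree_weight (contract R (delete S t)))"
    proof (rule sum.cong[OF refl])
      fix S assume S: "S \<in> leaf_blocks t"
      show "tree_weight (delete S t) = (\<Sum>R\<in>effective_edges t - {S}. tree_weight (contract R (delete S t)))"
        unfolding effective_edges_delete[OF ex subsetD[OF leaf_blocks_removable S], symmetric]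
        by (rule less.hyps) (use exD[OF S] big in auto)
    qed
    \<comment> \<open>Both double sums range over the pairs \<open>S \<noteq> R\<close>.\<close>
    also have "\<dots> = (\<Sum>R\<in>effective_edges t. \<Sum>S\<in>leaf_blocks t - {R}. tree_weight (delete S (contract R t)))"
    proof -
      have "effective_edges t - {S} = {R \<in> effective_edges t. R \<noteq> S}"
        "leaf_blocks t - {R} = {S \<in> leaf_blocks t. R \<noteq> S}" for S R
        by auto
      thus ?thesis
        unfolding delete_contract_commute
        by (simp only:) (rule sum.swap_restrict[OF finite_leaf_blocks[OF ex] finite_effective_edges[OF ex]])
    qed
    also have "\<dots> = (\<Sum>R\<in>effective_edges t. tree_weight (contract R t))"
    proof (rule sum.cong[OF refl])
      fix R assume R: "R \<in> effective_edges t"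
      show "(\<Sum>S\<in>leaf_blocks t - {R}. tree_weight (delete S (contract R t))) = tree_weight (contract R t)"
        using tree_weight_leaf_recursion[of "contract R t"] exC[OF R] big
          leaf_blocks_contract[OF ex R] by simp
    qed
    finally show ?thesis .
  qed
qed

theorem theorem2p22:
  fixes \<tau> :: exotic_tree
  assumes "tree_size \<tau> > 1"
  shows "fact (tree_size \<tau>) * inv_tree_fact \<tau> =
    (\<Sum>\<tau>'\<in>#R_minus \<tau>. fact (tree_size \<tau>') * inv_tree_fact \<tau>')"
proof (cases \<tau> rule: exotic_tree_cases)
  case (1 t)
  have size: "tree_size (abs_exotic_tree s) = lab_size s" if "exotic s" for s
    using tree_size.abs_eq[OF tree_iso_refl[OF that]] .
  have "R_minus \<tau> = {#abs_exotic_tree (contract R t). R \<in># mset_set (effective_edges t)#}"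
    using R_minus.abs_eq[OF 1(2)] 1(3) by (simp add: multiset.map_comp comp_def)
  hence "(\<Sum>\<tau>'\<in>#R_minus \<tau>. fact (tree_size \<tau>') * inv_tree_fact \<tau>') =
      (\<Sum>R\<in>effective_edges t. tree_weight (contract R t))"
    using size exotic_contract[OF 1(1)]
    by (simp add: multiset.map_comp comp_def tree_weight_def sum_unfold_sum_mset[symmetric])
  thus ?thesis
    using tree_weight_root_recursion[OF 1(1)] assms size[OF 1(1)] 1(3) by (simp add: tree_weight_def)
qed

end
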